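(* Let $n \geq 3$ and let $G_n$ be the $n\times n$ square grid graph, whose bandwidth is $n$. Then the minimal number of edges that must be deleted from $G_n$ in order to obtain a subgraph of bandwidth at most $n-1$ is exactly $2$. Moreover, there exist two edges of $G_n$ sharing a common endpoint whose deletion yields a subgraph of bandwidth at most $n-1$, and there also exist two edges of $G_n$ with no common endpoint whose deletion yields a subgraph of bandwidth at most $n-1$.
   Context: All graphs are finite, simple and undirected. A vertex numbering of a graph $G=(V,E)$ is a bijection $\nu: V \to \{1,2,\dots,|V|\}$. For an edge $e=uv$, its length induced by $\nu$ is $|\nu(u)-\nu(v)|$. The bandwidth of $\nu$ is the largest induced edge length (0 if $E=\emptyset$), and the bandwidth of $G$ is the minimum bandwidth over all vertex numberings of $G$. The square grid $G_n$ has vertex set $\{1,\dots,n\}\times\{1,\dots,n\}$, with two vertices adjacent iff their Euclidean distance is $1$; its bandwidth is $n$ for $n\ge 2$. *)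

theory Defs
  imports "HOL-Analysis.Analysis"
begin

text \<open>
  A finite simple undirected graph is represented by a finite vertex set \<open>V\<close> together with a set
  \<open>E\<close> of edges, each edge being a two-element subset of \<open>V\<close>. Deleting a set \<open>F\<close> of edges keeps
  the vertex set and replaces \<open>E\<close> by \<open>E - F\<close>.
\<close>

definition vertex_numbering :: "'a set \<Rightarrow> ('a \<Rightarrow> nat) \<Rightarrow> bool" where
  "vertex_numbering V \<nu> \<longleftrightarrow> bij_betw \<nu> V {1..card V}"

definition edge_lengths :: "'a set set \<Rightarrow> ('a \<Rightarrow> nat) \<Rightarrow> nat set" where
  "edge_lengths E \<nu> = {nat \<bar>int (\<nu> u) - int (\<nu> v)\<bar> | u v. {u, v} \<in> E}"

definition numbering_bandwidth :: "'a set set \<Rightarrow> ('a \<Rightarrow> nat) \<Rightarrow> nat" where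
  "numbering_bandwidth E \<nu> = (if E = {} then 0 else Max (edge_lengths E \<nu>))"

text \<open>
  The infimum below is a minimum: it is taken in \<^typ>\<open>nat\<close>, and a finite \<open>V\<close> has at least one
  vertex numbering.
\<close>

definition bandwidth :: "'a set \<Rightarrow> 'a set set \<Rightarrow> nat" where
  "bandwidth V E = (INF \<nu> \<in> {\<nu>. vertex_numbering V \<nu>}. numbering_bandwidth E \<nu>)"

text \<open>
  For finite \<open>V\<close> and \<open>E\<close> the set over which \<open>LEAST\<close> ranges is nonempty, since the edgeless graph
  has bandwidth 0. Requiring \<open>F\<close> to be finite rules out infinite sets, whose \<^const>\<open>card\<close> is 0.
\<close>

definition min_edge_deletions :: "'a set \<Rightarrow> 'a set set \<Rightarrow> nat \<Rightarrow> nat" where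
  "min_edge_deletions V E b =
     (LEAST k. \<exists>F. F \<subseteq> E \<and> finite F \<and> card F = k \<and> bandwidth V (E - F) \<le> b)"

definition grid_verts :: "nat \<Rightarrow> (nat \<times> nat) set" where
  "grid_verts n = {1..n} \<times> {1..n}"

text \<open>On \<^typ>\<open>real \<times> real\<close>, \<^const>\<open>dist\<close> is the Euclidean distance.\<close>

definition grid_edges :: "nat \<Rightarrow> (nat \<times> nat) set set" where
  "grid_edges n = {{u, v} | u v. u \<in> grid_verts n \<and> v \<in> grid_verts n \<and>
     dist (real (fst u), real (snd u)) (real (fst v), real (snd v)) = 1}"

end

theory Submission
  imports Defs
begin

text \<open>
  \<^emph>\<open>Upper bounds.\<close> Number the grid by antidiagonals. Only the steps between the three longest
  antidiagonals exceed the length \<open>n - 1\<close>, and they shrink once two vertices on the border of the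
  grid are moved to other antidiagonals, which costs two edges.

  \<^emph>\<open>Lower bound.\<close> Suppose that all edges but one, \<open>e\<close>, have length at most \<open>n - 1\<close>. For every \<open>k\<close>,
  the set of vertices numbered at most \<open>k\<close> then has at most \<open>n - 1\<close> outer and at most \<open>n - 1\<close> inner
  boundary vertices with respect to the edges other than \<open>e\<close>. When the first line becomes full, every
  column (up to transposition) meets both this set and its complement, and so contains boundary
  vertices of both kinds unless \<open>e\<close> is its only crossing edge. Hence \<open>e\<close> lies in some column \<open>c\<close>,
  column \<open>c\<close> has no boundary vertices, and every other column has exactly one of each kind. Now take
  the first \<open>k\<close> at which the set meets all columns, and call the number of its vertices in a column
  the height of that column. Heights of adjacent columns differ by at most 1. The height is 1 in the
  column met last, and at least \<open>n - 1\<close> in the column that becomes full first, because this happens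
  within \<open>n - 1\<close> further steps. But a neighbour of \<open>c\<close> has the same height as \<open>c\<close>, and a neighbour of
  the column met last also has height 1, so heights vary by at most \<open>n - 3\<close>.
\<close>

section \<open>Bandwidth and numberings\<close>

text \<open>Since {u, v} = {v, u}, the condition applies in both orders, so a one-sided inequality
  can replace the absolute difference.\<close>

lemma bandwidth_le_iff:
  fixes V :: "'a set"
  assumes fin: "finite V" and E: "\<And>e. e \<in> E \<Longrightarrow> \<exists>u\<in>V. \<exists>v\<in>V. e = {u, v}"
  shows "bandwidth V E \<le> b \<longleftrightarrow>
    (\<exists>\<nu>. vertex_numbering V \<nu> \<and> (\<forall>u v. {u, v} \<in> E \<longrightarrow> \<nu> u \<le> \<nu> v + b))"
proof -
  have numbering: "numbering_bandwidth E \<nu> \<le> b \<longleftrightarrow> (\<forall>u v. {u, v} \<in> E \<longrightarrow> \<nu> u \<le> \<nu> v + b)" for \<nu>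
  proof (cases "E = {}")
    case False
    have "edge_lengths E \<nu> \<subseteq> (\<lambda>(u, v). nat \<bar>int (\<nu> u) - int (\<nu> v)\<bar>) ` (V \<times> V)"
    proof
      fix l assume "l \<in> edge_lengths E \<nu>"
      then obtain u v where l: "l = nat \<bar>int (\<nu> u) - int (\<nu> v)\<bar>" "{u, v} \<in> E"
        by (auto simp: edge_lengths_def)
      have "u \<in> V" "v \<in> V"
        using E[OF l(2)] by (auto simp: doubleton_eq_iff)
      then show "l \<in> (\<lambda>(u, v). nat \<bar>int (\<nu> u) - int (\<nu> v)\<bar>) ` (V \<times> V)"
        using l(1) by auto
    qed
    then have "finite (edge_lengths E \<nu>)"
      using fin finite_subset by blast
    moreover have "edge_lengths E \<nu> \<noteq> {}"
      using E False by (fastforce simp: edge_lengths_def)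
    ultimately have "numbering_bandwidth E \<nu> \<le> b \<longleftrightarrow> (\<forall>l\<in>edge_lengths E \<nu>. l \<le> b)"
      using False by (simp add: numbering_bandwidth_def)
    also have "\<dots> \<longleftrightarrow> (\<forall>u v. {u, v} \<in> E \<longrightarrow> nat \<bar>int (\<nu> u) - int (\<nu> v)\<bar> \<le> b)"
      by (auto simp: edge_lengths_def)
    also have "\<dots> \<longleftrightarrow> (\<forall>u v. {u, v} \<in> E \<longrightarrow> \<nu> u \<le> \<nu> v + b)"
    proof safe
      fix u v
      { assume *: "\<forall>u v. {u, v} \<in> E \<longrightarrow> nat \<bar>int (\<nu> u) - int (\<nu> v)\<bar> \<le> b" "{u, v} \<in> E"
        then have "nat \<bar>int (\<nu> u) - int (\<nu> v)\<bar> \<le> b" by blast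
        then show "\<nu> u \<le> \<nu> v + b" by linarith }
      { assume *: "\<forall>u v. {u, v} \<in> E \<longrightarrow> \<nu> u \<le> \<nu> v + b" "{u, v} \<in> E"
        then have "\<nu> u \<le> \<nu> v + b" "\<nu> v \<le> \<nu> u + b" by (auto simp: insert_commute)
        then show "nat \<bar>int (\<nu> u) - int (\<nu> v)\<bar> \<le> b" by linarith }
    qed
    finally show ?thesis .
  qed (simp add: numbering_bandwidth_def)
  \<comment> \<open>Nonemptiness is what makes the infimum in \<open>nat\<close> attained.\<close>
  have ex: "{\<nu>. vertex_numbering V \<nu>} \<noteq> {}"
    using ex_bij_betw_finite_nat[OF fin] ex_bij_betw_nat_finite_1[OF fin] bij_betw_inv
    unfolding vertex_numbering_def by blast
  have "bandwidth V E \<le> b \<longleftrightarrow> (\<exists>\<nu>. vertex_numbering V \<nu> \<and> numbering_bandwidth E \<nu> \<le> b)"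
  proof
    assume "bandwidth V E \<le> b"
    moreover have "bandwidth V E \<in> numbering_bandwidth E ` {\<nu>. vertex_numbering V \<nu>}"
      unfolding bandwidth_def using ex by (intro Inf_nat_def1) auto
    ultimately show "\<exists>\<nu>. vertex_numbering V \<nu> \<and> numbering_bandwidth E \<nu> \<le> b"
      by auto
  next
    assume "\<exists>\<nu>. vertex_numbering V \<nu> \<and> numbering_bandwidth E \<nu> \<le> b"
    then obtain \<nu> where \<nu>: "vertex_numbering V \<nu>" "numbering_bandwidth E \<nu> \<le> b" by blast
    have "bandwidth V E \<le> numbering_bandwidth E \<nu>"
      unfolding bandwidth_def by (rule cInf_lower) (use \<nu> in auto)
    then show "bandwidth V E \<le> b" using \<nu>(2) by simp
  qed
  then show ?thesis using numbering by simp
qed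

text \<open>The numbering used here is the lexicographic one with respect to the level \<open>D\<close> and the position
  \<open>X\<close> within the level.\<close>
lemma bandwidth_le_levels:
  fixes V :: "'a set" and D X :: "'a \<Rightarrow> int"
  assumes fin: "finite V" and E: "\<And>e. e \<in> E \<Longrightarrow> \<exists>u\<in>V. \<exists>v\<in>V. e = {u, v}"
    and inj: "inj_on (\<lambda>p. (D p, X p)) V"
    and range: "\<And>q. q \<in> V \<Longrightarrow> lo (D q) \<le> X q \<and> X q \<le> hi (D q)"
    and step: "\<And>u v. {u, v} \<in> E \<Longrightarrow>
      D v = D u + 1 \<and> X v \<le> X u + 1 \<or> D u = D v + 1 \<and> X u \<le> X v + 1"
    and width: "\<And>s. hi s - lo (s + 1) + 2 \<le> int b"
  shows "bandwidth V E \<le> b"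
proof -
  define R where "R p = {q \<in> V. D q < D p \<or> D q = D p \<and> X q \<le> X p}" for p
  define \<nu> where "\<nu> p = card (R p)" for p
  have finR: "finite (R p)" for p using fin by (simp add: R_def)
  have less: "\<nu> p < \<nu> q" if "p \<in> V" "q \<in> V" "D p < D q \<or> D p = D q \<and> X p < X q" for p q
    unfolding \<nu>_def
  proof (rule psubset_card_mono[OF finR])
    have "R p \<subseteq> R q" "q \<in> R q - R p" using that by (auto simp: R_def)
    then show "R p \<subset> R q" by blast
  qed
  have "inj_on \<nu> V"
  proof (rule inj_onI, rule ccontr)
    fix p q assume pq: "p \<in> V" "q \<in> V" "\<nu> p = \<nu> q" "p \<noteq> q"
    then have "(D p, X p) \<noteq> (D q, X q)" using inj by (auto simp: inj_on_def)
    then show False using less[of p q] less[of q p] pq by force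
  qed
  moreover have "\<nu> ` V \<subseteq> {1..card V}"
  proof
    fix k assume "k \<in> \<nu> ` V"
    then obtain p where p: "p \<in> V" "k = \<nu> p" by blast
    have "R p \<subseteq> V" "p \<in> R p" using p by (auto simp: R_def)
    then have "card (R p) \<le> card V" "card (R p) \<noteq> 0"
      using fin finR by (auto intro: card_mono)
    then show "k \<in> {1..card V}" using p by (simp add: \<nu>_def)
  qed
  ultimately have num: "vertex_numbering V \<nu>"
    unfolding vertex_numbering_def bij_betw_def
    by (metis card_atLeastAtMost card_image card_subset_eq diff_Suc_1 finite_atLeastAtMost)
  \<comment> \<open>After \<open>u\<close> and up to \<open>v\<close> come the rest of the level of
    \<open>u\<close> and the initial part of the level of \<open>v\<close>, at most (hi (D u) - X u)
    + (X v - lo (D v) + 1) vertices. The inequality X v \<le> X u + 1 and \<open>width\<close> bound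
    this by \<open>b\<close>.\<close>
  have forward: "\<nu> v \<le> \<nu> u + b" if uv: "u \<in> V" "v \<in> V" "D v = D u + 1" "X v \<le> X u + 1" for u v
  proof -
    let ?f = "\<lambda>p. (D p, X p)"
    let ?A = "{D u} \<times> {X u<..hi (D u)} \<union> {D v} \<times> {lo (D v)..X v}"
    have "?f ` (R v - R u) \<subseteq> ?A"
      using range uv by (fastforce simp: R_def)
    moreover have "inj_on ?f (R v - R u)"
      by (rule inj_on_subset[OF inj]) (auto simp: R_def)
    ultimately have "card (R v - R u) \<le> card ?A"
      by (metis (no_types, lifting) card_image card_mono finite_SigmaI finite_Un finite_atLeastAtMost_int
          finite_greaterThanAtMost_int finite.emptyI finite_insert)
    also have "\<dots> \<le> card ({D u} \<times> {X u<..hi (D u)}) + card ({D v} \<times> {lo (D v)..X v})"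
      by (rule card_Un_le)
    also have "\<dots> = nat (hi (D u) - X u) + nat (X v - lo (D v) + 1)"
      by (simp add: card_cartesian_product algebra_simps)
    also have "\<dots> \<le> b"
      using range[OF uv(1)] range[OF uv(2)] uv width[of "D u"] by auto
    finally have "card (R v - R u) \<le> b" .
    moreover have "card (R v) \<le> card (R u) + card (R v - R u)"
      by (metis Un_Diff_cancel card_Un_le card_mono finR finite_Un order_trans sup_ge2)
    ultimately show ?thesis by (simp add: \<nu>_def)
  qed
  have "\<nu> u \<le> \<nu> v + b" if "{u, v} \<in> E" for u v
  proof -
    have uv: "u \<in> V" "v \<in> V" using E[OF that] by (auto simp: doubleton_eq_iff)
    from step[OF that] show ?thesis
    proof
      assume "D v = D u + 1 \<and> X v \<le> X u + 1"
      then have "\<nu> u < \<nu> v" using less uv by simp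
      then show ?thesis by simp
    next
      assume "D u = D v + 1 \<and> X u \<le> X v + 1"
      then show ?thesis using forward uv by blast
    qed
  qed
  then show ?thesis using bandwidth_le_iff[OF fin E] num by blast
qed

section \<open>Adjacency in the grid\<close>

text \<open>This is l1 distance 1, which agrees with Euclidean distance 1 on integer points;
  \<open>int\<close> avoids truncated subtraction.\<close>

definition grid_adj :: "nat \<times> nat \<Rightarrow> nat \<times> nat \<Rightarrow> bool" where
  "grid_adj u v \<longleftrightarrow> \<bar>int (fst u) - int (fst v)\<bar> + \<bar>int (snd u) - int (snd v)\<bar> = 1"

lemma grid_adj_commute: "grid_adj u v \<longleftrightarrow> grid_adj v u"
  by (simp add: grid_adj_def abs_minus_commute)

lemma grid_adj_Pair:
  "grid_adj (x, y) (x', y') \<longleftrightarrow>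
    x = x' \<and> (y' = Suc y \<or> y = Suc y') \<or> y = y' \<and> (x' = Suc x \<or> x = Suc x')"
  unfolding grid_adj_def by (auto simp: abs_if)

lemma dist_eq_1_iff_grid_adj:
  "dist (real (fst u), real (snd u)) (real (fst v), real (snd v)) = 1 \<longleftrightarrow> grid_adj u v"
proof -
  obtain x y x' y' where uv: "u = (x, y)" "v = (x', y')" by fastforce
  define a b where "a = int x - int x'" and "b = int y - int y'"
  have "dist (real x, real y) (real x', real y') = sqrt (real_of_int (a\<^sup>2 + b\<^sup>2))"
    by (simp add: dist_Pair_Pair dist_real_def a_def b_def)
  then have "dist (real x, real y) (real x', real y') = 1 \<longleftrightarrow> a\<^sup>2 + b\<^sup>2 = 1"
    by (simp only: real_sqrt_eq_1_iff of_int_eq_1_iff)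
  also have "\<dots> \<longleftrightarrow> \<bar>a\<bar> + \<bar>b\<bar> = 1"
  proof
    assume *: "a\<^sup>2 + b\<^sup>2 = 1"
    then have "a\<^sup>2 \<le> 1" "b\<^sup>2 \<le> 1" using zero_le_power2[of a] zero_le_power2[of b] by linarith+
    then have "\<bar>a\<bar> \<le> 1" "\<bar>b\<bar> \<le> 1" by (simp_all add: abs_square_le_1)
    then have "a \<in> {-1, 0, 1}" "b \<in> {-1, 0, 1}" by auto
    then show "\<bar>a\<bar> + \<bar>b\<bar> = 1" using * by auto
  next
    assume *: "\<bar>a\<bar> + \<bar>b\<bar> = 1"
    then have "a \<in> {-1, 0, 1}" "b \<in> {-1, 0, 1}" by auto
    then show "a\<^sup>2 + b\<^sup>2 = 1" using * by auto
  qed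
  finally show ?thesis by (simp add: uv grid_adj_def a_def b_def)
qed

lemma doubleton_in_grid_edges_iff:
  "{u, v} \<in> grid_edges n \<longleftrightarrow> u \<in> grid_verts n \<and> v \<in> grid_verts n \<and> grid_adj u v"
proof
  assume "{u, v} \<in> grid_edges n"
  then obtain u' v' where "{u, v} = {u', v'}" "u' \<in> grid_verts n" "v' \<in> grid_verts n" "grid_adj u' v'"
    unfolding grid_edges_def dist_eq_1_iff_grid_adj by blast
  then show "u \<in> grid_verts n \<and> v \<in> grid_verts n \<and> grid_adj u v"
    by (auto simp: doubleton_eq_iff grid_adj_commute)
next
  assume "u \<in> grid_verts n \<and> v \<in> grid_verts n \<and> grid_adj u v"
  then show "{u, v} \<in> grid_edges n"
    unfolding grid_edges_def dist_eq_1_iff_grid_adj by blast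
qed

lemma grid_edge_cases:
  assumes "{u, v} \<in> grid_edges n"
  obtains x y where "1 \<le> x" "x < n" "1 \<le> y" "y \<le> n"
      "u = (x, y) \<and> v = (Suc x, y) \<or> v = (x, y) \<and> u = (Suc x, y)"
  | x y where "1 \<le> x" "x \<le> n" "1 \<le> y" "y < n"
      "u = (x, y) \<and> v = (x, Suc y) \<or> v = (x, y) \<and> u = (x, Suc y)"
proof -
  obtain x y x' y' where [simp]: "u = (x, y)" "v = (x', y')" by fastforce
  have "x \<in> {1..n}" "y \<in> {1..n}" "x' \<in> {1..n}" "y' \<in> {1..n}" "grid_adj (x, y) (x', y')"
    using assms unfolding doubleton_in_grid_edges_iff by (auto simp: grid_verts_def)
  then show ?thesis
    unfolding grid_adj_Pair using that(1)[of x y] that(1)[of x' y] that(2)[of x y] that(2)[of x y']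
    by auto
qed

lemma grid_edgesE:
  assumes "e \<in> grid_edges n"
  shows "\<exists>u\<in>grid_verts n. \<exists>v\<in>grid_verts n. e = {u, v}"
  using assms unfolding grid_edges_def by blast

lemma finite_grid_verts: "finite (grid_verts n)"
  by (simp add: grid_verts_def)

section \<open>Numberings by antidiagonals\<close>

text \<open>The levels are the antidiagonals, and the first coordinate is the position. The width
  expression reaches n only for s = n and s = n + 1, the steps into and out of the longest
  antidiagonal; the next two constructions remove this excess.\<close>

lemma bandwidth_grid_le: "bandwidth (grid_verts n) (grid_edges n) \<le> n"
proof (rule bandwidth_le_levels)
  show "inj_on (\<lambda>p. (int (fst p) + int (snd p), int (fst p))) (grid_verts n)"
    by (auto simp: inj_on_def)
  show "max 1 (int (fst q) + int (snd q) - int n) \<le> int (fst q)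
    \<and> int (fst q) \<le> min (int n) (int (fst q) + int (snd q) - 1)" if "q \<in> grid_verts n" for q
    using that by (auto simp: grid_verts_def)
  show "min (int n) (s - 1) - max 1 (s + 1 - int n) + 2 \<le> int n" for s
    by auto
  show "int (fst v) + int (snd v) = int (fst u) + int (snd u) + 1 \<and> int (fst v) \<le> int (fst u) + 1
     \<or> int (fst u) + int (snd u) = int (fst v) + int (snd v) + 1 \<and> int (fst u) \<le> int (fst v) + 1"
    if "{u, v} \<in> grid_edges n" for u v
    using that unfolding doubleton_in_grid_edges_iff
    by (cases u; cases v) (auto simp: grid_adj_Pair)
qed (auto intro: finite_grid_verts dest: grid_edgesE)

text \<open>Both corners lie on the longest antidiagonal, level n + 1. After the deletion (1, n)
  keeps only its neighbour (1, n - 1) on level n, and (n, 1) only (n, 2) on level n + 2. Each corner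
  can therefore be reflected across that neighbour, to level n - 1 and n + 3 respectively.\<close>

lemma bandwidth_grid_delete_two_corner_edges:
  assumes "n \<ge> 3"
  shows "bandwidth (grid_verts n) (grid_edges n - {{(1, n), (2, n)}, {(n, 1), (n - 1, 1)}}) \<le> n - 1"
proof -
  define D where "D p = (if p = (1, n) then int n - 1 else if p = (n, 1) then int n + 3
    else int (fst p) + int (snd p))"
    for p :: "nat \<times> nat"
  \<comment> \<open>Positions 0 and n + 1 fit the step condition next to neighbours at positions 1
    and n. Lying outside {1..n}, they also tell the moved corners apart from all other
    vertices.\<close>
  define X where "X p = (if p = (1, n) then 0 else if p = (n, 1) then int n + 1
    else int (fst p))" for p :: "nat \<times> nat"
  \<comment> \<open>Level n + 1 loses both ends, while levels n - 1 and n + 3 each gain one position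
    at an end.\<close>
  define lo where "lo s = (if s \<le> int n - 2 then 1 else if s = int n - 1 then 0
    else if s = int n then 1 else if s = int n + 1 then 2 else s - int n)" for s
  define hi where "hi s = (if s \<le> int n then s - 1 else if s = int n + 1 then int n - 1
    else if s = int n + 3 then int n + 1 else int n)" for s
  have special: "D (1, n) = int n - 1" "D (n, 1) = int n + 3"
    "X (1, n) = 0" "X (n, 1) = int n + 1"
    using assms by (auto simp: D_def X_def)
  have ordinary: "D p = int (fst p) + int (snd p)" "X p = int (fst p)"
    if "p \<noteq> (1, n)" "p \<noteq> (n, 1)" for p
    using that by (auto simp: D_def X_def)
  have bounds: "1 \<le> fst p" "fst p \<le> n" "1 \<le> snd p" "snd p \<le> n" if "p \<in> grid_verts n" for p
    using that by (auto simp: grid_verts_def)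
  show ?thesis
  proof (rule bandwidth_le_levels[where D = D and X = X and lo = lo and hi = hi])
    show "inj_on (\<lambda>p. (D p, X p)) (grid_verts n)"
    proof (rule inj_onI)
      fix p q assume pq: "p \<in> grid_verts n" "q \<in> grid_verts n" "(D p, X p) = (D q, X q)"
      have outside: "r = (1, n) \<or> r = (n, 1) \<longleftrightarrow> X r \<notin> {1..int n}" if "r \<in> grid_verts n" for r
      proof (cases "r = (1, n) \<or> r = (n, 1)")
        case True
        then show ?thesis using special by (elim disjE) simp_all
      next
        case False
        then show ?thesis using bounds[OF that] ordinary[of r] by simp
      qed
      show "p = q"
      proof (cases "X p \<in> {1..int n}")
        case True
        moreover from this have "X q \<in> {1..int n}" using pq(3) by simp
        ultimately have "p \<noteq> (1, n)" "p \<noteq> (n, 1)" "q \<noteq> (1, n)" "q \<noteq> (n, 1)"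
          using outside[OF pq(1)] outside[OF pq(2)] by blast+
        then show ?thesis using pq(3) by (simp add: ordinary prod_eq_iff)
      next
        case False
        moreover from this have "X q \<notin> {1..int n}" using pq(3) by simp
        ultimately have "p = (1, n) \<or> p = (n, 1)" "q = (1, n) \<or> q = (n, 1)"
          using outside[OF pq(1)] outside[OF pq(2)] by blast+
        then show ?thesis using pq(3) special by (elim disjE) simp_all
      qed
    qed
    show "lo (D q) \<le> X q \<and> X q \<le> hi (D q)" if "q \<in> grid_verts n" for q
    proof -
      consider "q = (1, n)" | "q = (n, 1)" | "q \<noteq> (1, n)" "q \<noteq> (n, 1)" by blast
      then show ?thesis
      proof cases
        case 3
        then have "\<not> (fst q = 1 \<and> snd q = n)" "\<not> (fst q = n \<and> snd q = 1)"
          by (auto simp: prod_eq_iff)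
        then have "lo (int (fst q) + int (snd q)) \<le> int (fst q)
            \<and> int (fst q) \<le> hi (int (fst q) + int (snd q))"
          unfolding lo_def hi_def using bounds[OF that] assms
          by (smt (verit) of_nat_diff of_nat_1 of_nat_le_iff of_nat_eq_iff)
        then show ?thesis using 3 by (simp add: ordinary)
      qed (use assms special in \<open>simp_all add: lo_def hi_def\<close>)
    qed
    show "hi s - lo (s + 1) + 2 \<le> int (n - 1)" for s
    proof -
      have "int (n - 1) = int n - 1" "int n \<ge> 3" using assms by auto
      then show ?thesis unfolding lo_def hi_def by auto
    qed
    show "D v = D u + 1 \<and> X v \<le> X u + 1 \<or> D u = D v + 1 \<and> X u \<le> X v + 1"
      if uv: "{u, v} \<in> grid_edges n - {{(1, n), (2, n)}, {(n, 1), (n - 1, 1)}}" for u v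
    proof -
      have "{u, v} \<in> grid_edges n" using uv by simp
      then show ?thesis
      proof (cases rule: grid_edge_cases)
        case (1 x y)
        then have "{u, v} = {(x, y), (Suc x, y)}" by auto
        then have "{(x, y), (Suc x, y)} \<noteq> {(1, n), (2, n)}"
          "{(x, y), (Suc x, y)} \<noteq> {(n, 1), (n - 1, 1)}"
          using uv by auto
        then have "\<not> (x = 1 \<and> y = n)" "\<not> (Suc x = n \<and> y = 1)"
          by (auto simp: doubleton_eq_iff numeral_2_eq_2)
        then have "(x, y) \<noteq> (1, n)" "(x, y) \<noteq> (n, 1)" "(Suc x, y) \<noteq> (1, n)" "(Suc x, y) \<noteq> (n, 1)"
          using 1 by auto
        then have "D (Suc x, y) = D (x, y) + 1 \<and> X (Suc x, y) \<le> X (x, y) + 1"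
          by (simp add: ordinary del: prod.inject)
        then show ?thesis using 1(5) by blast
      next
        case (2 x y)
        then have *: "(x, y) \<noteq> (1, n)" "(x, Suc y) \<noteq> (n, 1)"
          by auto
        have "D (x, Suc y) = D (x, y) + 1 \<and> X (x, Suc y) \<le> X (x, y) + 1
            \<or> D (x, y) = D (x, Suc y) + 1 \<and> X (x, y) \<le> X (x, Suc y) + 1"
        proof -
          consider "(x, Suc y) = (1, n)" | "(x, y) = (n, 1)"
            | "(x, y) \<noteq> (n, 1)" "(x, Suc y) \<noteq> (1, n)" by blast
          then show ?thesis
          proof cases
            case 1
            then show ?thesis using special ordinary[of "(x, y)"] assms by auto
          next
            case 2
            then show ?thesis using special ordinary[of "(x, Suc y)"] assms by auto
          next
            case 3
            then show ?thesis using * by (simp add: ordinary del: prod.inject)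
          qed
        qed
        then show ?thesis using 2(5) by blast
      qed
    qed
  qed (auto intro: finite_grid_verts dest: grid_edgesE)
qed

text \<open>After the deletion (n - 1, 1) hangs on (n, 1) alone, which in turn hangs on (n, 2). This
  tail is unfolded upwards from level n + 2: (n, 1) goes to level n + 3 and (n - 1, 1) to level n +
  4, so that levels n and n + 1 lose their last vertices.\<close>

lemma bandwidth_grid_delete_two_incident_edges:
  assumes "n \<ge> 3"
  shows "bandwidth (grid_verts n) (grid_edges n - {{(n - 1, 1), (n - 2, 1)}, {(n - 1, 1), (n - 1, 2)}}) \<le> n - 1"
proof -
  define D where "D p = (if p = (n - 1, 1) then int n + 4 else if p = (n, 1) then int n + 3
    else int (fst p) + int (snd p))"
    for p :: "nat \<times> nat"
  define X where "X p = (if p = (n - 1, 1) then int n + 1 else if p = (n, 1) then int n + 1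
    else int (fst p))" for p :: "nat \<times> nat"
  define lo where "lo s = (if s \<le> int n then 1 else s - int n)" for s
  define hi where "hi s = (if s \<le> int n - 1 then s - 1 else if s \<le> int n + 1 then s - 2
    else if s = int n + 3 \<or> s = int n + 4 then int n + 1 else int n)" for s
  have special: "D (n - 1, 1) = int n + 4" "D (n, 1) = int n + 3"
    "X (n - 1, 1) = int n + 1" "X (n, 1) = int n + 1"
    using assms by (auto simp: D_def X_def)
  have ordinary: "D p = int (fst p) + int (snd p)" "X p = int (fst p)"
    if "p \<noteq> (n - 1, 1)" "p \<noteq> (n, 1)" for p
    using that by (auto simp: D_def X_def)
  have bounds: "1 \<le> fst p" "fst p \<le> n" "1 \<le> snd p" "snd p \<le> n" if "p \<in> grid_verts n" for p
    using that by (auto simp: grid_verts_def)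
  show ?thesis
  proof (rule bandwidth_le_levels[where D = D and X = X and lo = lo and hi = hi])
    show "inj_on (\<lambda>p. (D p, X p)) (grid_verts n)"
    proof (rule inj_onI)
      fix p q assume pq: "p \<in> grid_verts n" "q \<in> grid_verts n" "(D p, X p) = (D q, X q)"
      have outside: "r = (n - 1, 1) \<or> r = (n, 1) \<longleftrightarrow> X r \<notin> {1..int n}" if "r \<in> grid_verts n" for r
      proof (cases "r = (n - 1, 1) \<or> r = (n, 1)")
        case True
        then show ?thesis using special by (elim disjE) simp_all
      next
        case False
        then show ?thesis using bounds[OF that] ordinary[of r] by simp
      qed
      show "p = q"
      proof (cases "X p \<in> {1..int n}")
        case True
        moreover from this have "X q \<in> {1..int n}" using pq(3) by simp
        ultimately have "p \<noteq> (n - 1, 1)" "p \<noteq> (n, 1)" "q \<noteq> (n - 1, 1)" "q \<noteq> (n, 1)"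
          using outside[OF pq(1)] outside[OF pq(2)] by blast+
        then show ?thesis using pq(3) by (simp add: ordinary prod_eq_iff)
      next
        case False
        moreover from this have "X q \<notin> {1..int n}" using pq(3) by simp
        ultimately have "p = (n - 1, 1) \<or> p = (n, 1)" "q = (n - 1, 1) \<or> q = (n, 1)"
          using outside[OF pq(1)] outside[OF pq(2)] by blast+
        then show ?thesis using pq(3) special by (elim disjE) simp_all
      qed
    qed
    show "lo (D q) \<le> X q \<and> X q \<le> hi (D q)" if "q \<in> grid_verts n" for q
    proof -
      consider "q = (n - 1, 1)" | "q = (n, 1)" | "q \<noteq> (n - 1, 1)" "q \<noteq> (n, 1)" by blast
      then show ?thesis
      proof cases
        case 3
        then have "\<not> (fst q = n - 1 \<and> snd q = 1)" "\<not> (fst q = n \<and> snd q = 1)"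
          by (auto simp: prod_eq_iff)
        then have "lo (int (fst q) + int (snd q)) \<le> int (fst q)
            \<and> int (fst q) \<le> hi (int (fst q) + int (snd q))"
          unfolding lo_def hi_def using bounds[OF that] assms
          by (smt (verit) of_nat_diff of_nat_1 of_nat_le_iff of_nat_eq_iff)
        then show ?thesis using 3 by (simp add: ordinary)
      qed (use assms special in \<open>simp_all add: lo_def hi_def\<close>)
    qed
    show "hi s - lo (s + 1) + 2 \<le> int (n - 1)" for s
    proof -
      have "int (n - 1) = int n - 1" "int n \<ge> 3" using assms by auto
      then show ?thesis unfolding lo_def hi_def by auto
    qed
    show "D v = D u + 1 \<and> X v \<le> X u + 1 \<or> D u = D v + 1 \<and> X u \<le> X v + 1"
      if uv: "{u, v} \<in> grid_edges n - {{(n - 1, 1), (n - 2, 1)}, {(n - 1, 1), (n - 1, 2)}}" for u v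
    proof -
      have "{u, v} \<in> grid_edges n" using uv by simp
      then show ?thesis
      proof (cases rule: grid_edge_cases)
        case (1 x y)
        then have "{u, v} = {(x, y), (Suc x, y)}" by auto
        then have "{(x, y), (Suc x, y)} \<noteq> {(n - 1, 1), (n - 2, 1)}"
          using uv by auto
        then have "\<not> (Suc x = n - 1 \<and> y = 1)" by (auto simp: doubleton_eq_iff)
        then have "(x, y) \<noteq> (n, 1)" "(Suc x, y) \<noteq> (n - 1, 1)"
          "(x, y) = (n - 1, 1) \<longleftrightarrow> (Suc x, y) = (n, 1)"
          using 1 assms by auto
        moreover from this have "D (Suc x, y) = D (x, y) + 1 \<and> X (Suc x, y) \<le> X (x, y) + 1
            \<or> D (x, y) = D (Suc x, y) + 1 \<and> X (x, y) \<le> X (Suc x, y) + 1"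
          using special ordinary[of "(x, y)"] ordinary[of "(Suc x, y)"]
          by (cases "(x, y) = (n - 1, 1)") (simp_all del: prod.inject)
        ultimately show ?thesis using 1(5) by blast
      next
        case (2 x y)
        then have "{u, v} = {(x, y), (x, Suc y)}" by auto
        then have "{(x, y), (x, Suc y)} \<noteq> {(n - 1, 1), (n - 1, 2)}"
          using uv by auto
        then have *: "(x, y) \<noteq> (n - 1, 1)" "(x, Suc y) \<noteq> (n - 1, 1)" "(x, Suc y) \<noteq> (n, 1)"
          using 2 by (auto simp: numeral_2_eq_2)
        have "D (x, Suc y) = D (x, y) + 1 \<and> X (x, Suc y) \<le> X (x, y) + 1
            \<or> D (x, y) = D (x, Suc y) + 1 \<and> X (x, y) \<le> X (x, Suc y) + 1"
        proof (cases "(x, y) = (n, 1)")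
          case True
          then show ?thesis using special ordinary[of "(x, Suc y)"] assms by auto
        next
          case False
          then show ?thesis using * by (simp add: ordinary del: prod.inject)
        qed
        then show ?thesis using 2(5) by blast
      qed
    qed
  qed (auto intro: finite_grid_verts dest: grid_edgesE)
qed

section \<open>Numberings in which only one edge is long\<close>

text \<open>Each step at which \<open>g\<close> changes contributes at most 1. Counting only these
  steps lets every flat step sharpen the bound.\<close>

lemma abs_diff_le_card_changes:
  fixes g :: "nat \<Rightarrow> int"
  assumes lipschitz: "\<And>i. i \<in> {1..<n} \<Longrightarrow> \<bar>g (Suc i) - g i\<bar> \<le> 1"
    and xy: "x \<in> {1..n}" "y \<in> {1..n}"
  shows "\<bar>g y - g x\<bar> \<le> int (card {i \<in> {1..<n}. g (Suc i) \<noteq> g i})"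
proof -
  have aux: "\<bar>g y - g x\<bar> \<le> int (card {i \<in> {x..<y}. g (Suc i) \<noteq> g i})"
    if "x \<le> y" "1 \<le> x" "y \<le> n" for x y
    using that
  proof (induction y rule: dec_induct)
    case (step m)
    have "{i \<in> {x..<Suc m}. g (Suc i) \<noteq> g i} =
      (if g (Suc m) = g m then {} else {m}) \<union> {i \<in> {x..<m}. g (Suc i) \<noteq> g i}"
      using step.hyps by (auto simp: less_Suc_eq)
    then have "card {i \<in> {x..<Suc m}. g (Suc i) \<noteq> g i} =
      (if g (Suc m) = g m then 0 else 1) + card {i \<in> {x..<m}. g (Suc i) \<noteq> g i}"
      by simp
    moreover have "\<bar>g (Suc m) - g m\<bar> \<le> (if g (Suc m) = g m then 0 else 1)"
      using lipschitz[of m] step by auto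
    moreover have "\<bar>g m - g x\<bar> \<le> int (card {i \<in> {x..<m}. g (Suc i) \<noteq> g i})"
      using step by simp
    ultimately show ?case by (auto split: if_splits)
  qed simp
  have mono: "card {i \<in> {x..<y}. g (Suc i) \<noteq> g i} \<le> card {i \<in> {1..<n}. g (Suc i) \<noteq> g i}"
    if "1 \<le> x" "y \<le> n" for x y
    by (rule card_mono) (use that in auto)
  show ?thesis
  proof (cases "x \<le> y")
    case True
    then show ?thesis using aux[of x y] mono[of x y] xy by simp
  next
    case False
    then show ?thesis using aux[of y x] mono[of y x] xy by simp
  qed
qed

text \<open>The set \<open>e\<close> is arbitrary, so the case without any long edge is covered as
  well.\<close>

locale almost_narrow_numbering =
  fixes n :: nat and e :: "(nat \<times> nat) set" and \<nu> :: "nat \<times> nat \<Rightarrow> nat"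
  assumes n3: "3 \<le> n"
    and inj: "inj_on \<nu> (grid_verts n)"
    and pos: "p \<in> grid_verts n \<Longrightarrow> 0 < \<nu> p"
    and short: "\<lbrakk>p \<in> grid_verts n; q \<in> grid_verts n; grid_adj p q; {p, q} \<noteq> e\<rbrakk>
      \<Longrightarrow> \<nu> p \<le> \<nu> q + (n - 1)"
begin

section \<open>Initial segments of the numbering and their boundaries\<close>

definition low :: "nat \<Rightarrow> nat \<Rightarrow> nat set" where
  "low k i = {y \<in> {1..n}. \<nu> (i, y) \<le> k}"

definition mixed :: "nat \<Rightarrow> nat \<Rightarrow> bool" where
  "mixed k i \<longleftrightarrow> low k i \<noteq> {} \<and> low k i \<noteq> {1..n}"

definition outer :: "nat \<Rightarrow> (nat \<times> nat) set" where
  "outer k = {p \<in> grid_verts n. k < \<nu> p \<and>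
     (\<exists>q\<in>grid_verts n. \<nu> q \<le> k \<and> grid_adj p q \<and> {p, q} \<noteq> e)}"

definition inner :: "nat \<Rightarrow> (nat \<times> nat) set" where
  "inner k = {p \<in> grid_verts n. \<nu> p \<le> k \<and>
     (\<exists>q\<in>grid_verts n. k < \<nu> q \<and> grid_adj p q \<and> {p, q} \<noteq> e)}"

lemma low_mono: "k \<le> l \<Longrightarrow> low k i \<subseteq> low l i"
  by (auto simp: low_def)

lemma low_subset: "low k i \<subseteq> {1..n}"
  by (auto simp: low_def)

lemma finite_low: "finite (low k i)"
  by (simp add: low_def)

lemma finite_outer: "finite (outer k)"
  using finite_grid_verts[of n] by (simp add: outer_def)

lemma nu_outer: "\<nu> ` outer k \<subseteq> {Suc k..k + (n - 1)}"
  using short by (fastforce simp: outer_def)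

lemma inj_outer: "inj_on \<nu> (outer k)"
  using inj by (rule inj_on_subset) (auto simp: outer_def)

lemma card_outer: "card (outer k) \<le> n - 1"
  using card_mono[OF _ nu_outer[of k]] card_image[OF inj_outer[of k]] by simp

lemma card_inner: "card (inner k) \<le> n - 1"
proof -
  \<comment> \<open>If the subtraction truncates to 0, the interval {0..k} still has at most n - 1
    elements.\<close>
  have "\<nu> ` inner k \<subseteq> {Suc k - (n - 1)..k}"
  proof
    fix m assume "m \<in> \<nu> ` inner k"
    then obtain p q where pq: "p \<in> grid_verts n" "q \<in> grid_verts n" "m = \<nu> p" "\<nu> p \<le> k" "k < \<nu> q"
      "grid_adj q p" "{q, p} \<noteq> e"
      by (auto simp: inner_def grid_adj_commute insert_commute)
    then have "\<nu> q \<le> \<nu> p + (n - 1)" using short by blast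
    then show "m \<in> {Suc k - (n - 1)..k}" using pq by simp
  qed
  moreover have "inj_on \<nu> (inner k)"
    using inj by (rule inj_on_subset) (auto simp: inner_def)
  ultimately have "card (inner k) \<le> card {Suc k - (n - 1)..k}"
    by (metis card_image card_mono finite_atLeastAtMost)
  then show ?thesis by simp
qed

text \<open>If no vertical edge crossed, lowness would propagate by induction from row 1 along the
  whole column.\<close>

lemma mixedE:
  assumes "mixed k i"
  obtains a b where "a \<in> {1..n}" "b \<in> {1..n}" "grid_adj (i, a) (i, b)" "\<nu> (i, a) \<le> k" "k < \<nu> (i, b)"
proof (rule ccontr)
  assume "\<not> thesis"
  with that have none: "\<not> (\<nu> (i, a) \<le> k \<and> k < \<nu> (i, b))"
    if "a \<in> {1..n}" "b \<in> {1..n}" "grid_adj (i, a) (i, b)" for a b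
    using that by blast
  have "\<nu> (i, y) \<le> k \<longleftrightarrow> \<nu> (i, 1) \<le> k" if "1 \<le> y" "y \<le> n" for y
    using that
  proof (induction y rule: dec_induct)
    case (step m)
    then show ?case
      using none[of m "Suc m"] none[of "Suc m" m] by (auto simp: grid_adj_Pair)
  qed simp
  then have "low k i = {} \<or> low k i = {1..n}"
    by (cases "\<nu> (i, 1) \<le> k") (auto simp: low_def)
  then show False using assms by (auto simp: mixed_def)
qed

lemma mixed_outer_inner:
  assumes "i \<in> {1..n}" "mixed k i" "\<not> e \<subseteq> {i} \<times> UNIV"
  shows "i \<in> fst ` outer k" "i \<in> fst ` inner k"
proof -
  from assms(2) obtain a b where ab: "a \<in> {1..n}" "b \<in> {1..n}" "grid_adj (i, a) (i, b)"
    "\<nu> (i, a) \<le> k" "k < \<nu> (i, b)" by (rule mixedE)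
  have "{(i, b), (i, a)} \<noteq> e" "{(i, a), (i, b)} \<noteq> e" using assms(3) by auto
  then have "(i, b) \<in> outer k" "(i, a) \<in> inner k"
    using ab assms(1) grid_adj_commute[of "(i, a)" "(i, b)"]
    unfolding outer_def inner_def grid_verts_def by blast+
  then show "i \<in> fst ` outer k" "i \<in> fst ` inner k" by force+
qed

lemma not_all_columns:
  assumes "A \<subseteq> grid_verts n" "card A \<le> n - 1"
  shows "\<exists>c\<in>{1..n}. c \<notin> fst ` A"
proof (rule ccontr)
  assume "\<not> ?thesis"
  then have "{1..n} \<subseteq> fst ` A" by blast
  moreover have "finite A" using assms(1) finite_grid_verts finite_subset by blast
  ultimately have "n \<le> card A"
    by (metis card_atLeastAtMost card_image_le card_mono diff_Suc_1 finite_imageI le_trans)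
  then show False using assms(2) n3 by simp
qed

text \<open>The outer boundary has too few vertices to meet all n columns. A column that it misses
  is still mixed, and its crossing edge can only be the excluded one.\<close>

lemma critical_column:
  assumes "\<forall>i\<in>{1..n}. mixed k i"
  shows "\<exists>c\<in>{1..n}. \<exists>a\<in>{1..n}. \<exists>b\<in>{1..n}. grid_adj (c, a) (c, b) \<and> e = {(c, a), (c, b)}
    \<and> \<nu> (c, a) \<le> k \<and> k < \<nu> (c, b)"
proof -
  obtain c where c: "c \<in> {1..n}" "c \<notin> fst ` outer k"
    using not_all_columns[of "outer k"] card_outer by (auto simp: outer_def)
  then have "mixed k c" using assms by blast
  then obtain a b where ab: "a \<in> {1..n}" "b \<in> {1..n}" "grid_adj (c, a) (c, b)"
    "\<nu> (c, a) \<le> k" "k < \<nu> (c, b)" by (rule mixedE)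
  have "(c, b) \<notin> outer k" using c(2) by force
  then have "{(c, b), (c, a)} = e"
    using ab c(1) grid_adj_commute[of "(c, a)" "(c, b)"] unfolding outer_def grid_verts_def by blast
  then show ?thesis using ab c(1) insert_commute by blast
qed

text \<open>The pigeonhole bound is tight here: at most n - 1 vertices hit n - 1 columns, so each of
  these is hit once and nothing is left for \<open>c\<close>.\<close>

lemma columns_of:
  assumes "c \<in> {1..n}" "A \<subseteq> grid_verts n" "card A \<le> n - 1" "{1..n} - {c} \<subseteq> fst ` A"
  shows "fst ` A = {1..n} - {c}" "inj_on fst A" "card A = n - 1"
proof -
  have "finite A" using assms(2) finite_grid_verts finite_subset by blast
  have "c \<notin> fst ` A"
    using not_all_columns[OF assms(2,3)] assms(4) by blast
  moreover have "fst ` A \<subseteq> {1..n}" using assms(2) by (auto simp: grid_verts_def)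
  ultimately show *: "fst ` A = {1..n} - {c}" using assms(4) by blast
  have "card (fst ` A) = n - 1" using assms(1) by (simp add: *)
  moreover from this show "card A = n - 1"
    using card_image_le[OF \<open>finite A\<close>, of fst] assms(3) by simp
  ultimately show "inj_on fst A" using \<open>finite A\<close> by (simp add: eq_card_imp_inj_on)
qed

section \<open>Heights of columns when the exceptional edge lies in column c\<close>

context
  fixes c a b
  assumes e: "e = {(c, a), (c, b)}" and c: "c \<in> {1..n}"
begin

text \<open>The horizontal edge in row \<open>y\<close> crosses, and it is not \<open>e\<close>,
  because \<open>e\<close> lies within one column.\<close>

lemma low_diff:
  assumes "i \<in> {1..n}" "j \<in> {1..n}" "j = Suc i \<or> i = Suc j" "y \<in> low k i - low k j"
  shows "(j, y) \<in> outer k" "(i, y) \<in> inner k"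
proof -
  have "grid_adj (j, y) (i, y)" "grid_adj (i, y) (j, y)"
    using assms(3) by (auto simp: grid_adj_Pair)
  moreover have "{(j, y), (i, y)} \<noteq> e" "{(i, y), (j, y)} \<noteq> e"
    using assms(3) by (auto simp: e doubleton_eq_iff)
  moreover have "(i, y) \<in> grid_verts n" "(j, y) \<in> grid_verts n" "\<nu> (i, y) \<le> k" "k < \<nu> (j, y)"
    using assms by (auto simp: low_def grid_verts_def)
  ultimately show "(j, y) \<in> outer k" "(i, y) \<in> inner k"
    unfolding outer_def inner_def by blast+
qed

lemma all_mixed:
  assumes "\<forall>i\<in>{1..n}. mixed k i"
  shows "fst ` outer k = {1..n} - {c}" "inj_on fst (outer k)" "card (outer k) = n - 1"
    "fst ` inner k = {1..n} - {c}"
proof -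
  have "\<not> e \<subseteq> {i} \<times> UNIV" if "i \<noteq> c" for i using that by (auto simp: e)
  then have hit: "{1..n} - {c} \<subseteq> fst ` outer k" "{1..n} - {c} \<subseteq> fst ` inner k"
    using assms mixed_outer_inner by blast+
  have sub: "outer k \<subseteq> grid_verts n" "inner k \<subseteq> grid_verts n"
    by (auto simp: outer_def inner_def)
  show "fst ` outer k = {1..n} - {c}" "inj_on fst (outer k)" "card (outer k) = n - 1"
    by (fact columns_of[OF c sub(1) card_outer hit(1)])+
  show "fst ` inner k = {1..n} - {c}"
    by (fact columns_of(1)[OF c sub(2) card_inner hit(2)])
qed

text \<open>Column \<open>c\<close> contains no boundary vertex of either kind, so no horizontal
  edge at \<open>c\<close> crosses. The missing inner vertices give one inclusion, the missing outer
  vertices the other.\<close>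

lemma low_critical:
  assumes "\<forall>i\<in>{1..n}. mixed k i" "i \<in> {1..n}" "c = Suc i \<or> i = Suc c"
  shows "low k i = low k c"
proof -
  have "low k c - low k i = {}"
  proof (rule equals0I)
    fix y assume "y \<in> low k c - low k i"
    then have "(c, y) \<in> inner k" using low_diff(2)[of c i] assms c by blast
    then show False using all_mixed(4)[OF assms(1)] by (metis DiffE fst_conv imageI singletonI)
  qed
  moreover have "low k i - low k c = {}"
  proof (rule equals0I)
    fix y assume "y \<in> low k i - low k c"
    then have "(c, y) \<in> outer k" using low_diff(1)[of i c] assms c by blast
    then show False using all_mixed(1)[OF assms(1)] by (metis DiffE fst_conv imageI singletonI)
  qed
  ultimately show ?thesis by blast
qed

text \<open>Every row that is low in column \<open>i\<close> but not in \<open>j\<close> puts an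
  outer boundary vertex into column \<open>j\<close>, which has at most one.\<close>

lemma card_low_le:
  assumes "\<forall>i\<in>{1..n}. mixed k i" "i \<in> {1..n}" "j \<in> {1..n}" "j = Suc i \<or> i = Suc j"
  shows "card (low k i) \<le> card (low k j) + 1"
proof -
  have "Pair j ` (low k i - low k j) \<subseteq> {p \<in> outer k. fst p = j}"
    using low_diff(1)[OF assms(2-4)] by auto
  moreover have "card {p \<in> outer k. fst p = j} \<le> 1"
    using all_mixed(2)[OF assms(1)] finite_outer
    by (subst card_le_Suc0_iff_eq[unfolded One_nat_def[symmetric]]) (auto simp: inj_on_def)
  moreover have "finite {p \<in> outer k. fst p = j}" using finite_outer by simp
  ultimately have "card (Pair j ` (low k i - low k j)) \<le> 1"
    by (meson card_mono order_trans)
  then have "card (low k i - low k j) \<le> 1"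
    by (simp add: card_image inj_on_def)
  then show ?thesis
    using diff_card_le_card_Diff[OF finite_low, of "low k i" k j] by linarith
qed

end

section \<open>Contradiction from a moment at which all columns are mixed\<close>

lemma some_column_not_mixed: "\<exists>i\<in>{1..n}. \<not> mixed k\<^sub>0 i"
proof (rule ccontr)
  assume "\<not> ?thesis"
  then have k\<^sub>0: "\<forall>i\<in>{1..n}. mixed k\<^sub>0 i" by blast
  define t where "t = (LEAST k. \<forall>i\<in>{1..n}. low k i \<noteq> {})"
  define f where "f = (LEAST k. \<exists>i\<in>{1..n}. low k i = {1..n})"
  have t_hit: "\<forall>i\<in>{1..n}. low t i \<noteq> {}"
    unfolding t_def by (rule LeastI[of _ k\<^sub>0]) (use k\<^sub>0 in \<open>auto simp: mixed_def\<close>)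
  have "t \<le> k\<^sub>0"
    unfolding t_def by (rule Least_le) (use k\<^sub>0 in \<open>auto simp: mixed_def\<close>)
  have "low (Max (\<nu> ` grid_verts n)) 1 = {1..n}"
    using n3 finite_grid_verts[of n] by (auto simp: low_def grid_verts_def)
  then have "\<exists>i\<in>{1..n}. low (Max (\<nu> ` grid_verts n)) i = {1..n}" using n3 by force
  then have f_full: "\<exists>i\<in>{1..n}. low f i = {1..n}" unfolding f_def by (rule LeastI)
  have "k\<^sub>0 < f"
  proof (rule ccontr)
    assume "\<not> k\<^sub>0 < f"
    obtain i where i: "i \<in> {1..n}" "low f i = {1..n}" using f_full by blast
    then have "low k\<^sub>0 i = {1..n}"
      using low_mono[of f k\<^sub>0 i] low_subset[of k\<^sub>0 i] \<open>\<not> k\<^sub>0 < f\<close> by simp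
    then show False using k\<^sub>0 i(1) unfolding mixed_def by blast
  qed
  have below_f: "low k i \<noteq> {1..n}" if "k < f" "i \<in> {1..n}" for k i
    using not_less_Least[OF that(1)[unfolded f_def]] that(2) by blast
  have mixed_between: "\<forall>i\<in>{1..n}. mixed k i" if "t \<le> k" "k < f" for k
    using t_hit low_mono[OF that(1)] below_f[OF that(2)] unfolding mixed_def by blast
  have mixed_t: "\<forall>i\<in>{1..n}. mixed t i" and mixed_f: "\<forall>i\<in>{1..n}. mixed (f - 1) i"
    using mixed_between \<open>t \<le> k\<^sub>0\<close> \<open>k\<^sub>0 < f\<close> by auto

  obtain c a b where c: "c \<in> {1..n}" "a \<in> {1..n}" "b \<in> {1..n}" and ab: "grid_adj (c, a) (c, b)"
    and e: "e = {(c, a), (c, b)}" and a: "\<nu> (c, a) \<le> t" and b: "t < \<nu> (c, b)"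
    using critical_column[OF mixed_t] by blast
  obtain c' a' b' where e': "e = {(c', a'), (c', b')}" and a': "\<nu> (c', a') \<le> f - 1"
    and b': "f - 1 < \<nu> (c', b')"
    using critical_column[OF mixed_f] by blast
  \<comment> \<open>The end of \<open>e\<close> that is low at \<open>t\<close> is still low at f -
    1, so the end that is high at f - 1 is (c, b).\<close>
  have "(c, b) = (c', b')"
    using e e' a a' b' \<open>t \<le> k\<^sub>0\<close> \<open>k\<^sub>0 < f\<close> by (auto simp: doubleton_eq_iff)
  then have cb: "f - 1 < \<nu> (c, b)" using b' by simp
  note mixed_t' = all_mixed[OF e c(1) mixed_t]
  note critical_t = low_critical[OF e c(1) mixed_t]
  \<comment> \<open>These are n - 1 distinct numbers in an interval of n - 1 numbers, so they fill
    it.\<close>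
  have nu_outer_t: "\<nu> ` outer t = {Suc t..t + (n - 1)}"
    using nu_outer card_image[OF inj_outer[of t]] mixed_t'(3) by (intro card_subset_eq) auto
  \<comment> \<open>A neighbouring column \<open>d\<close> has the same low rows as \<open>c\<close>
    at \<open>t\<close> and at f - 1, so (d, b) is high at both moments. Its edge to the low vertex
    (d, a) is not \<open>e\<close>, hence is short.\<close>
  have "f \<le> t + (n - 1)"
  proof -
    define d where "d = (if c < n then Suc c else c - 1)"
    have d: "d \<in> {1..n}" "c = Suc d \<or> d = Suc c" using c n3 by (auto simp: d_def)
    have "a \<in> low t d" "b \<notin> low t d"
      using a b c critical_t[OF d] by (auto simp: low_def)
    then have "\<nu> (d, a) \<le> t" "t < \<nu> (d, b)" using c by (auto simp: low_def)
    moreover have "{(d, b), (d, a)} \<noteq> e" using d by (auto simp: e doubleton_eq_iff)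
    moreover have "grid_adj (d, b) (d, a)" using ab by (auto simp: grid_adj_Pair)
    ultimately have "(d, b) \<in> outer t"
      using c d unfolding outer_def grid_verts_def by blast
    then have "\<nu> (d, b) \<le> t + (n - 1)" using nu_outer[of t] by fastforce
    moreover have "b \<notin> low (f - 1) d"
      using cb low_critical[OF e c(1) mixed_f d] by (auto simp: low_def)
    then have "f - 1 < \<nu> (d, b)" using c by (auto simp: low_def)
    ultimately show ?thesis by simp
  qed

  obtain y where y: "y \<in> {1..n}" "low f y = {1..n}" using f_full by blast
  \<comment> \<open>All vertices of column \<open>y\<close> that are high at \<open>t\<close> have
    numbers in {t + 1..f}, hence belong to the outer boundary at \<open>t\<close>.\<close>
  have "Pair y ` ({1..n} - low t y) \<subseteq> {p \<in> outer t. fst p = y}"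
  proof safe
    fix r assume r: "r \<in> {1..n}" "r \<notin> low t y"
    then have "r \<in> low f y" using y(2) by simp
    then have "\<nu> (y, r) \<le> f" "t < \<nu> (y, r)" using r(2) by (auto simp: low_def)
    then have "\<nu> (y, r) \<in> \<nu> ` outer t"
      unfolding nu_outer_t using \<open>f \<le> t + (n - 1)\<close> by simp
    then obtain p where "p \<in> outer t" "\<nu> p = \<nu> (y, r)" by auto
    moreover have "(y, r) \<in> grid_verts n" using y(1) r by (simp add: grid_verts_def)
    ultimately have "p = (y, r)" using inj by (auto simp: outer_def dest: inj_onD)
    then show "(y, r) \<in> outer t" using \<open>p \<in> outer t\<close> by simp
  qed simp
  moreover have "card {p \<in> outer t. fst p = y} \<le> 1"
    using mixed_t'(2) finite_outer
    by (subst card_le_Suc0_iff_eq[unfolded One_nat_def[symmetric]]) (auto simp: inj_on_def)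
  moreover have "finite {p \<in> outer t. fst p = y}" using finite_outer by simp
  ultimately have "card (Pair y ` ({1..n} - low t y)) \<le> 1"
    by (meson card_mono order_trans)
  then have "card ({1..n} - low t y) \<le> 1"
    by (simp add: card_image inj_on_def)
  then have h_y: "n - 1 \<le> card (low t y)"
    using card_Diff_subset[OF finite_low low_subset, of t y] by simp

  have "t > 0"
  proof -
    obtain r where "r \<in> low t y" using t_hit y(1) by blast
    then show ?thesis using pos[of "(y, r)"] y(1) by (auto simp: low_def grid_verts_def)
  qed
  \<comment> \<open>By minimality of \<open>t\<close> some column is empty at t - 1; its only low
    vertex at \<open>t\<close> is the one numbered \<open>t\<close>.\<close>
  then obtain x where x: "x \<in> {1..n}" "low (t - 1) x = {}"
    using not_less_Least[of "t - 1" "\<lambda>k. \<forall>i\<in>{1..n}. low k i \<noteq> {}"] unfolding t_def by auto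
  obtain y\<^sub>0 where y\<^sub>0: "y\<^sub>0 \<in> low t x" using t_hit x(1) by blast
  have nu_x: "\<nu> (x, r) = t" if "r \<in> low t x" for r
    using that x(2) \<open>t > 0\<close> by (auto simp: low_def)
  have at_t: "(i, r) = (x, y\<^sub>0)" if "i \<in> {1..n}" "r \<in> {1..n}" "\<nu> (i, r) = t" for i r
    using that inj_onD[OF inj, of "(i, r)" "(x, y\<^sub>0)"] nu_x[OF y\<^sub>0] y\<^sub>0 x(1)
    by (auto simp: low_def grid_verts_def)
  have "r = y\<^sub>0" if "r \<in> low t x" for r
    using at_t[OF x(1), of r] nu_x[OF that] that low_subset by blast
  then have "low t x = {y\<^sub>0}" using y\<^sub>0 by blast
  then have h_x: "card (low t x) = 1" by simp
  have low_before: "low (t - 1) i = low t i" if "i \<in> {1..n}" "i \<noteq> x" for i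
  proof
    show "low t i \<subseteq> low (t - 1) i"
    proof
      fix r assume r: "r \<in> low t i"
      then have "\<nu> (i, r) \<noteq> t" using at_t[OF that(1), of r] that(2) by (auto simp: low_def)
      then show "r \<in> low (t - 1) i" using r by (auto simp: low_def)
    qed
  qed (simp add: low_mono)

  text \<open>Just before \<open>t\<close> the untouched column \<open>x\<close> contributes to the boundary once for every
    low vertex of a neighbouring column.\<close>
  have nbr_x: "x \<noteq> c \<and> card (low t x') = 1"
    if x': "x' \<in> {1..n}" "x = Suc x' \<or> x' = Suc x" for x'
  proof -
    let ?A = "{p \<in> outer (t - 1). fst p = x}" and ?B = "{p \<in> outer (t - 1). fst p \<noteq> x}"
    have "x' \<noteq> x" using x'(2) by auto
    have "Pair x ` low t x' \<subseteq> ?A"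
      using low_diff(1)[OF e c(1) x'(1) x(1), of _ "t - 1"] x'(2) x(2)
        low_before[OF x'(1) \<open>x' \<noteq> x\<close>] by auto
    then have "card (Pair x ` low t x') \<le> card ?A"
      using finite_outer by (intro card_mono) auto
    then have A: "card (low t x') \<le> card ?A"
      by (simp add: card_image inj_on_def)
    \<comment> \<open>Every column other than \<open>c\<close> and \<open>x\<close> is already mixed
      at t - 1 and adds an outer vertex of its own, which leaves room for just one in column
      \<open>x\<close>, and for none if x = c.\<close>
    have "{1..n} - {c, x} \<subseteq> fst ` ?B"
    proof
      fix i assume i: "i \<in> {1..n} - {c, x}"
      then have "mixed (t - 1) i" using mixed_t low_before[of i] by (auto simp: mixed_def)
      moreover have "\<not> e \<subseteq> {i} \<times> UNIV" using i by (auto simp: e)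
      ultimately have "i \<in> fst ` outer (t - 1)" using mixed_outer_inner(1)[of i] i by blast
      then show "i \<in> fst ` ?B" using i by auto
    qed
    then have "card ({1..n} - {c, x}) \<le> card (fst ` ?B)"
      using finite_outer by (intro card_mono) auto
    also have "\<dots> \<le> card ?B" using finite_outer by (intro card_image_le) auto
    finally have B: "card ({1..n} - {c, x}) \<le> card ?B" .
    have "card ?A + card ?B = card (outer (t - 1))"
      using finite_outer[of "t - 1"] by (subst card_Un_disjoint[symmetric]) (auto intro: arg_cong[of _ _ card])
    then have total: "card (low t x') + card ({1..n} - {c, x}) \<le> n - 1"
      using A B card_outer[of "t - 1"] by linarith
    have "card (low t x') \<noteq> 0" using t_hit x'(1) finite_low by auto
    moreover have "x \<noteq> c"
    proof
      assume "x = c"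
      then have "card ({1..n} - {c, x}) = n - 1" using c(1) by simp
      then show False using total \<open>card (low t x') \<noteq> 0\<close> by simp
    qed
    moreover from this have "card ({1..n} - {c, x}) = n - 2"
      using c(1) x(1) by (simp add: card_Diff_subset)
    ultimately show ?thesis using total n3 by linarith
  qed
  have "x \<noteq> c"
  proof (cases "x < n")
    case True
    then show ?thesis using nbr_x[of "Suc x"] by simp
  next
    case False
    then show ?thesis using nbr_x[of "x - 1"] x(1) n3 by simp
  qed

  let ?g = "\<lambda>i. int (card (low t i))"
  let ?Z = "{i \<in> {1..<n}. ?g (Suc i) \<noteq> ?g i}"
  have variation: "\<bar>?g y - ?g x\<bar> \<le> int (card ?Z)"
  proof (rule abs_diff_le_card_changes)
    fix i assume "i \<in> {1..<n}"
    then show "\<bar>?g (Suc i) - ?g i\<bar> \<le> 1"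
      using card_low_le[OF e c(1) mixed_t, of i "Suc i"] card_low_le[OF e c(1) mixed_t, of "Suc i" i]
      by simp
  qed (use x y in auto)
  have flat: "i \<notin> ?Z" "i - 1 \<notin> ?Z" if i: "i \<in> {c, x}" for i
  proof -
    have eq: "card (low t j) = card (low t i)" if "j \<in> {1..n}" "i = Suc j \<or> j = Suc i" for j
      using i critical_t[of j] nbr_x[of j] h_x that by auto
    show "i \<notin> ?Z" using eq[of "Suc i"] by auto
    show "i - 1 \<notin> ?Z" using eq[of "i - 1"] i c(1) x(1) by auto
  qed
  \<comment> \<open>An interior column \<open>c\<close> has two flat steps. If \<open>c\<close> is
    at an end, it has one, and \<open>x\<close> supplies another, distinct because n \<ge>
    3.\<close>
  obtain i j where "i \<in> {1..<n}" "j \<in> {1..<n}" "i \<noteq> j" "i \<notin> ?Z" "j \<notin> ?Z"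
  proof -
    let ?I = "{c - 1, c, x - 1, x} \<inter> {1..<n}"
    have "\<exists>i j. i \<in> ?I \<and> j \<in> ?I \<and> i \<noteq> j"
    proof (cases "c \<in> {1<..<n}")
      case True
      then have "c - 1 \<in> ?I" "c \<in> ?I" "c - 1 \<noteq> c" by auto
      then show ?thesis by blast
    next
      case False
      then have "c = 1 \<or> c = n" using c(1) by auto
      then show ?thesis
      proof
        assume "c = 1"
        then have "c \<in> ?I" "(if x = n then x - 1 else x) \<in> ?I" "c \<noteq> (if x = n then x - 1 else x)"
          using x(1) \<open>x \<noteq> c\<close> n3 by auto
        then show ?thesis by blast
      next
        assume "c = n"
        then have "c - 1 \<in> ?I" "(if x = 1 then x else x - 1) \<in> ?I"
          "c - 1 \<noteq> (if x = 1 then x else x - 1)"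
          using x(1) \<open>x \<noteq> c\<close> n3 by auto
        then show ?thesis by blast
      qed
    qed
    then show thesis using that flat[of c] flat[of x] by blast
  qed
  then have "card ?Z \<le> card ({1..<n} - {i, j})" by (intro card_mono) auto
  also have "\<dots> = n - 3"
    using \<open>i \<in> {1..<n}\<close> \<open>j \<in> {1..<n}\<close> \<open>i \<noteq> j\<close> by (simp add: card_Diff_subset)
  \<comment> \<open>The heights of \<open>x\<close> and \<open>y\<close> differ by at least n - 2,
    but at most n - 3 steps change the height.\<close>
  finally show False using variation h_x h_y n3 by linarith
qed

text \<open>At \<open>f\<close> the row meets every column, so all columns are mixed unless some
  column is full at \<open>f\<close> too. In that case all columns are mixed already at f -
  1.\<close>

lemma full_row_first:
  assumes row: "j\<^sub>0 \<in> {1..n}" "\<And>i. i \<in> {1..n} \<Longrightarrow> \<nu> (i, j\<^sub>0) \<le> f"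
    and first: "\<And>k i. k < f \<Longrightarrow> i \<in> {1..n} \<Longrightarrow> low k i \<noteq> {1..n}"
  shows False
proof (cases "\<exists>i\<in>{1..n}. low f i = {1..n}")
  case False
  have "low f i \<noteq> {}" if "i \<in> {1..n}" for i using row that by (auto simp: low_def)
  then show False using some_column_not_mixed[of f] False unfolding mixed_def by blast
next
  case True
  then obtain i\<^sub>0 where i\<^sub>0: "i\<^sub>0 \<in> {1..n}" "low f i\<^sub>0 = {1..n}" by blast
  have "f > 0" using row pos[of "(1, j\<^sub>0)"] n3 by (force simp: grid_verts_def)
  have "low (f - 1) i \<noteq> {}" if i: "i \<in> {1..n}" for i
  proof
    assume empty: "low (f - 1) i = {}"
    have j\<^sub>0: "\<nu> (i, j\<^sub>0) = f"
      using row(1) row(2)[OF i] empty by (fastforce simp: low_def)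
    have at_f: "(i\<^sub>0, j) = (i, j\<^sub>0)" if "j \<in> {1..n}" "j \<notin> low (f - 1) i\<^sub>0" for j
    proof -
      have "j \<in> low f i\<^sub>0" using that(1) i\<^sub>0(2) by simp
      then have "\<nu> (i\<^sub>0, j) = f" using that by (auto simp: low_def)
      then show ?thesis
        using j\<^sub>0 that(1) row(1) i i\<^sub>0(1) by (intro inj_onD[OF inj]) (auto simp: grid_verts_def)
    qed
    obtain j where "j \<in> {1..n}" "j \<notin> low (f - 1) i\<^sub>0"
      using first[of "f - 1" i\<^sub>0] \<open>f > 0\<close> i\<^sub>0(1) low_subset[of "f - 1" i\<^sub>0] by force
    then have "i\<^sub>0 = i" using at_f by blast
    then have "(i\<^sub>0, 1) = (i, j\<^sub>0)" "(i\<^sub>0, 2) = (i, j\<^sub>0)" using at_f[of 1] at_f[of 2] empty n3 by auto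
    then show False by simp
  qed
  then have "\<forall>i\<in>{1..n}. mixed (f - 1) i"
    using first[of "f - 1"] \<open>f > 0\<close> unfolding mixed_def by auto
  then show False using some_column_not_mixed by blast
qed

end

section \<open>Transposition and the lower bound\<close>

lemma almost_narrow_numbering_transpose:
  assumes "almost_narrow_numbering n e \<nu>"
  shows "almost_narrow_numbering n (prod.swap ` e) (\<nu> \<circ> prod.swap)"
proof -
  interpret almost_narrow_numbering n e \<nu> by fact
  have swap: "prod.swap p \<in> grid_verts n \<longleftrightarrow> p \<in> grid_verts n" for p
    by (cases p) (auto simp: grid_verts_def)
  show ?thesis
  proof
    show "inj_on (\<nu> \<circ> prod.swap) (grid_verts n)"
      by (rule comp_inj_on) (use inj in \<open>auto simp: grid_verts_def product_swap\<close>)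
    show "(\<nu> \<circ> prod.swap) p \<le> (\<nu> \<circ> prod.swap) q + (n - 1)"
      if "p \<in> grid_verts n" "q \<in> grid_verts n" "grid_adj p q" "{p, q} \<noteq> prod.swap ` e" for p q
    proof -
      have "grid_adj (prod.swap p) (prod.swap q)"
        using that(3) by (simp add: grid_adj_def)
      moreover have "{prod.swap p, prod.swap q} \<noteq> e"
      proof
        assume "{prod.swap p, prod.swap q} = e"
        then have "prod.swap ` e = {p, q}" by auto
        then show False using that(4) by simp
      qed
      ultimately show ?thesis using short[of "prod.swap p" "prod.swap q"] that(1,2) swap by simp
    qed
  qed (use n3 pos swap in auto)
qed

lemma no_almost_narrow_numbering: "\<not> almost_narrow_numbering n e \<nu>"
proof
  assume A: "almost_narrow_numbering n e \<nu>"
  interpret A: almost_narrow_numbering n e \<nu> by fact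
  interpret B: almost_narrow_numbering n "prod.swap ` e" "\<nu> \<circ> prod.swap"
    by (rule almost_narrow_numbering_transpose) fact
  \<comment> \<open>The columns of \<open>B\<close> are the rows of the grid. A line that is full
    for one of \<open>A\<close> and \<open>B\<close> is a full row for the other, so
    \<open>full_row_first\<close> applies to the other.\<close>
  define line where "line k \<longleftrightarrow> (\<exists>i\<in>{1..n}. A.low k i = {1..n} \<or> B.low k i = {1..n})" for k
  define f where "f = (LEAST k. line k)"
  have "A.low (Max (\<nu> ` grid_verts n)) 1 = {1..n}"
    using A.n3 finite_grid_verts[of n] by (auto simp: A.low_def grid_verts_def)
  then have "line (Max (\<nu> ` grid_verts n))" using A.n3 unfolding line_def by force
  then have "line f" unfolding f_def by (rule LeastI)
  moreover have first: "A.low k i \<noteq> {1..n}" "B.low k i \<noteq> {1..n}" if "k < f" "i \<in> {1..n}" for k i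
    using not_less_Least[OF that(1)[unfolded f_def]] that(2) unfolding line_def by blast+
  ultimately obtain i where i: "i \<in> {1..n}" "A.low f i = {1..n} \<or> B.low f i = {1..n}"
    unfolding line_def by blast
  from i(2) show False
  proof
    assume "A.low f i = {1..n}"
    then have "j \<in> A.low f i" if "j \<in> {1..n}" for j using that by simp
    then have "(\<nu> \<circ> prod.swap) (j, i) \<le> f" if "j \<in> {1..n}" for j
      using that by (simp add: A.low_def)
    then show False using B.full_row_first[OF i(1)] first(2) by blast
  next
    assume "B.low f i = {1..n}"
    then have "j \<in> B.low f i" if "j \<in> {1..n}" for j using that by simp
    then have "\<nu> (j, i) \<le> f" if "j \<in> {1..n}" for j
      using that by (simp add: B.low_def)
    then show False using A.full_row_first[OF i(1)] first(1) by blast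
  qed
qed

text \<open>Allowing \<open>F\<close> to be empty serves two purposes: it bounds the bandwidth of
  the whole grid from below, and it treats zero and one deletions together.\<close>

lemma bandwidth_grid_delete_edge:
  assumes "n \<ge> 3" "F \<subseteq> {e}"
  shows "\<not> bandwidth (grid_verts n) (grid_edges n - F) \<le> n - 1"
proof
  assume "bandwidth (grid_verts n) (grid_edges n - F) \<le> n - 1"
  moreover have "\<exists>u\<in>grid_verts n. \<exists>v\<in>grid_verts n. d = {u, v}" if "d \<in> grid_edges n - F" for d
    using that grid_edgesE by blast
  ultimately obtain \<nu> where \<nu>: "vertex_numbering (grid_verts n) \<nu>"
    and short: "\<And>u v. {u, v} \<in> grid_edges n - F \<Longrightarrow> \<nu> u \<le> \<nu> v + (n - 1)"
    using bandwidth_le_iff[OF finite_grid_verts] by blast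
  have "almost_narrow_numbering n e \<nu>"
  proof
    show "inj_on \<nu> (grid_verts n)" "\<And>p. p \<in> grid_verts n \<Longrightarrow> 0 < \<nu> p"
      using \<nu> unfolding vertex_numbering_def bij_betw_def by fastforce+
    fix p q assume pq: "p \<in> grid_verts n" "q \<in> grid_verts n" "grid_adj p q" "{p, q} \<noteq> e"
    then have "{p, q} \<notin> F" using assms(2) by auto
    then show "\<nu> p \<le> \<nu> q + (n - 1)"
      using pq short doubleton_in_grid_edges_iff by blast
  qed (fact assms(1))
  then show False using no_almost_narrow_numbering by blast
qed

theorem theorem4:
  fixes n :: nat
  assumes "n \<ge> 3"
  shows "bandwidth (grid_verts n) (grid_edges n) = n
    \<and> min_edge_deletions (grid_verts n) (grid_edges n) (n - 1) = 2
    \<and> (\<exists>e \<in> grid_edges n. \<exists>f \<in> grid_edges n. e \<noteq> f \<and> e \<inter> f \<noteq> {} \<and>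
         bandwidth (grid_verts n) (grid_edges n - {e, f}) \<le> n - 1)
    \<and> (\<exists>e \<in> grid_edges n. \<exists>f \<in> grid_edges n. e \<inter> f = {} \<and>
         bandwidth (grid_verts n) (grid_edges n - {e, f}) \<le> n - 1)"
proof (intro conjI)
  have edge: "{(n - 1, 1), (n - 2, 1)} \<in> grid_edges n" "{(n - 1, 1), (n - 1, 2)} \<in> grid_edges n"
      "{(1, n), (2, n)} \<in> grid_edges n" "{(n, 1), (n - 1, 1)} \<in> grid_edges n"
    using assms by (auto simp: doubleton_in_grid_edges_iff grid_verts_def grid_adj_Pair)
  show "bandwidth (grid_verts n) (grid_edges n) = n"
    using bandwidth_grid_delete_edge[OF assms, of "{}"] bandwidth_grid_le[of n] by simp
  show incident: "\<exists>e \<in> grid_edges n. \<exists>f \<in> grid_edges n. e \<noteq> f \<and> e \<inter> f \<noteq> {} \<and>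
      bandwidth (grid_verts n) (grid_edges n - {e, f}) \<le> n - 1"
  proof (rule bexI[OF _ edge(1)], rule bexI[OF _ edge(2)], intro conjI)
    show "{(n - 1, 1), (n - 2, 1)} \<noteq> {(n - 1, 1), (n - 1, 2 :: nat)}"
        "{(n - 1, 1), (n - 2, 1)} \<inter> {(n - 1, 1), (n - 1, 2 :: nat)} \<noteq> {}"
      by (auto simp: doubleton_eq_iff)
  qed (fact bandwidth_grid_delete_two_incident_edges[OF assms])
  show "\<exists>e \<in> grid_edges n. \<exists>f \<in> grid_edges n. e \<inter> f = {} \<and>
      bandwidth (grid_verts n) (grid_edges n - {e, f}) \<le> n - 1"
  proof -
    have "{(1, n), (2, n)} \<inter> {(n, 1), (n - 1, 1)} = {}"
      using assms by auto
    then show ?thesis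
      using edge(3,4) bandwidth_grid_delete_two_corner_edges[OF assms] by blast
  qed
  show "min_edge_deletions (grid_verts n) (grid_edges n) (n - 1) = 2"
    unfolding min_edge_deletions_def
  proof (rule Least_equality)
    obtain e f where "e \<in> grid_edges n" "f \<in> grid_edges n" "e \<noteq> f"
      "bandwidth (grid_verts n) (grid_edges n - {e, f}) \<le> n - 1"
      using incident by blast
    then show "\<exists>F\<subseteq>grid_edges n. finite F \<and> card F = 2
        \<and> bandwidth (grid_verts n) (grid_edges n - F) \<le> n - 1"
      by (intro exI[of _ "{e, f}"]) auto
  next
    fix k assume "\<exists>F\<subseteq>grid_edges n. finite F \<and> card F = k
        \<and> bandwidth (grid_verts n) (grid_edges n - F) \<le> n - 1"
    then obtain F where F: "finite F" "card F = k"
      "bandwidth (grid_verts n) (grid_edges n - F) \<le> n - 1" by blast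
    show "2 \<le> k"
    proof (rule ccontr)
      assume "\<not> 2 \<le> k"
      then have "card F \<le> 1" using F(2) by simp
      then obtain e where "F \<subseteq> {e}"
        using F(1) by (metis One_nat_def card_le_Suc0_iff_eq singletonI subsetI)
      then show False using bandwidth_grid_delete_edge[OF assms] F(3) by blast
    qed
  qed
qed

end
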